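(* Let $e\in\mathbb{R}$. For $a,\epsilon\in\,]0,1[$ let $\vec E_{a,\epsilon}(\vec r\,)=e\big[\Upsilon_2(r)-\Upsilon'_1(r)\big]\vec u$ be the Colombeau-regularized electric field of a point charge, where $\Upsilon_2$ and $\Upsilon'_1$ are the regularizations of $r^{-2}\mathrm{H}(r-a)$ and $r^{-1}\delta(r-a)$ given in the context. Then the electric self-energy $$U_{\mathrm{ele}}(a,\epsilon)=\frac{1}{8\pi}\int_{\mathbb{R}^3}|\vec E_{a,\epsilon}(\vec r\,)|^2\,d^3r$$ satisfies, for every fixed $a\in\,]0,1[$, $$\lim_{\epsilon\to0^+}\left(U_{\mathrm{ele}}(a,\epsilon)-\frac{e^2}{2}\,\frac{M}{\epsilon}\right)=0,\qquad M=\int_{-\infty}^{\infty}\eta(-z)^2\,dz .$$ In particular the diverging expression for the self-energy does not depend on $a$.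
   Context: Mollifier: $\eta\in\mathcal{S}(\mathbb{R})$ is a fixed real-valued even Schwartz function with $\int_{\mathbb{R}}\eta(z)\,dz=1$ and $\int_{\mathbb{R}}z^n\eta(z)\,dz=0$ for all integers $n\ge1$. A distribution $f$ on $\mathbb{R}$ is regularized as $f_\epsilon(x)=\int_{\mathbb{R}}\frac1\epsilon\,\eta\big(\frac{y-x}{\epsilon}\big)f(y)\,dy$ (with the usual distributional meaning). Regularized functions: $\vec r\in\mathbb{R}^3$, $r=|\vec r\,|\ge0$, $\vec u=\vec r/r$, $\mathrm{H}$ is the Heaviside function, $\delta$ the Dirac distribution. For $n\ge1$, $\Upsilon_n$ and $\Upsilon'_n$ (depending on $a,\epsilon$) denote the regularizations of the distributions $y\mapsto y^{-n}\mathrm{H}(y-a)$ and $y\mapsto y^{-n}\delta(y-a)$, that is, $$\Upsilon_n(r)=\int_{(a-r)/\epsilon}^{\infty}\frac{\eta(z)}{(r+\epsilon z)^n}\,dz,\qquad \Upsilon'_n(r)=\frac{1}{a^n\epsilon}\,\eta\Big(\frac{a-r}{\epsilon}\Big).$$ In the formal notation $\Upsilon_n=r^{-n}\Upsilon$, $\Upsilon_n'=r^{-n}\Upsilon'$, the field is $\vec E=e\big(r^{-2}\Upsilon-r^{-1}\Upsilon'\big)\vec u=-\vec\nabla(e\,r^{-1}\Upsilon)$. The limit $\epsilon\to0$ is always taken before $a\to0$. *)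

theory Defs
  imports "HOL-Analysis.Analysis"
begin

definition schwartz :: "(real \<Rightarrow> real) \<Rightarrow> bool" where
  "schwartz f \<longleftrightarrow>
     (\<forall>k x. (deriv ^^ k) f differentiable (at x)) \<and>
     (\<forall>m k. bounded (range (\<lambda>x. x ^ m * (deriv ^^ k) f x)))"

definition mollifier :: "(real \<Rightarrow> real) \<Rightarrow> bool" where
  "mollifier \<eta> \<longleftrightarrow>
     schwartz \<eta> \<and>
     (\<forall>z. \<eta> (- z) = \<eta> z) \<and>
     (LINT z|lborel. \<eta> z) = 1 \<and>
     (\<forall>n\<ge>1. (LINT z|lborel. z ^ n * \<eta> z) = 0)"

text \<open>A distribution on the real line is represented by its action on test functions. The pairing
  of \<open>T\<close> with the test function \<open>\<phi>\<close>, formally the integral of \<open>T(y) \<phi>(y)\<close>, is the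
  application \<open>T \<phi>\<close>.\<close>

type_synonym distribution = "(real \<Rightarrow> real) \<Rightarrow> real"

definition fun_dist :: "(real \<Rightarrow> real) \<Rightarrow> distribution" where
  "fun_dist g \<phi> = (LINT y|lborel. g y * \<phi> y)"

definition dirac :: "real \<Rightarrow> distribution" where
  "dirac a \<phi> = \<phi> a"

definition mult_dist :: "(real \<Rightarrow> real) \<Rightarrow> distribution \<Rightarrow> distribution" where
  "mult_dist g T \<phi> = T (\<lambda>y. g y * \<phi> y)"

definition heaviside :: "real \<Rightarrow> real" where
  "heaviside = indicator {0..}"

definition regularize :: "(real \<Rightarrow> real) \<Rightarrow> real \<Rightarrow> distribution \<Rightarrow> real \<Rightarrow> real" where
  "regularize \<eta> \<epsilon> T x = T (\<lambda>y. 1 / \<epsilon> * \<eta> ((y - x) / \<epsilon>))"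

text \<open>The factor \<open>1 / y ^ n\<close> is singular only at \<open>0\<close>, outside the supports of the distributions
  it multiplies, since \<open>a > 0\<close> throughout.\<close>

definition Upsilon :: "(real \<Rightarrow> real) \<Rightarrow> real \<Rightarrow> real \<Rightarrow> nat \<Rightarrow> real \<Rightarrow> real" where
  "Upsilon \<eta> a \<epsilon> n =
     regularize \<eta> \<epsilon> (fun_dist (\<lambda>y. 1 / y ^ n * heaviside (y - a)))"

definition Upsilon' :: "(real \<Rightarrow> real) \<Rightarrow> real \<Rightarrow> real \<Rightarrow> nat \<Rightarrow> real \<Rightarrow> real" where
  "Upsilon' \<eta> a \<epsilon> n =
     regularize \<eta> \<epsilon> (mult_dist (\<lambda>y. 1 / y ^ n) (dirac a))"

lemma Upsilon_eq:
  assumes "\<epsilon> > 0"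
  shows "Upsilon \<eta> a \<epsilon> n r = (LINT z:{(a - r) / \<epsilon>..}|lborel. \<eta> z / (r + \<epsilon> * z) ^ n)"
proof -
  have "Upsilon \<eta> a \<epsilon> n r =
      (LINT y|lborel. 1 / y ^ n * heaviside (y - a) * (1 / \<epsilon> * \<eta> ((y - r) / \<epsilon>)))"
    by (simp add: Upsilon_def regularize_def fun_dist_def)
  also have "\<dots> = \<epsilon> * (LINT z|lborel. 1 / (r + \<epsilon> * z) ^ n * heaviside (r + \<epsilon> * z - a) *
      (1 / \<epsilon> * \<eta> z))"
    using assms by (subst lborel_integral_real_affine[where c = \<epsilon> and t = r]) simp_all
  also have "\<dots> = (LINT z|lborel. \<epsilon> * (1 / (r + \<epsilon> * z) ^ n * heaviside (r + \<epsilon> * z - a) *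
      (1 / \<epsilon> * \<eta> z)))"
    by (simp only: integral_mult_right_zero)
  also have "\<dots> = (LINT z:{(a - r) / \<epsilon>..}|lborel. \<eta> z / (r + \<epsilon> * z) ^ n)"
    unfolding set_lebesgue_integral_def using assms
    by (intro Bochner_Integration.integral_cong)
       (auto simp: heaviside_def indicator_def field_simps)
  finally show ?thesis .
qed

lemma Upsilon'_eq: "Upsilon' \<eta> a \<epsilon> n r = 1 / (a ^ n * \<epsilon>) * \<eta> ((a - r) / \<epsilon>)"
  by (simp add: Upsilon'_def regularize_def mult_dist_def dirac_def)

text \<open>Here \<open>sgn x = x /\<^sub>R norm x\<close> is the unit radial vector.\<close>

definition E_field :: "(real \<Rightarrow> real) \<Rightarrow> real \<Rightarrow> real \<Rightarrow> real \<Rightarrow> real ^ 3 \<Rightarrow> real ^ 3" where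
  "E_field \<eta> e a \<epsilon> x =
     (e * (Upsilon \<eta> a \<epsilon> 2 (norm x) - Upsilon' \<eta> a \<epsilon> 1 (norm x))) *\<^sub>R sgn x"

definition U_ele :: "(real \<Rightarrow> real) \<Rightarrow> real \<Rightarrow> real \<Rightarrow> real \<Rightarrow> real" where
  "U_ele \<eta> e a \<epsilon> = 1 / (8 * pi) * (LINT x|lborel. (norm (E_field \<eta> e a \<epsilon> x))\<^sup>2)"

end

theory Submission
  imports Defs "HOL-Probability.Sinc_Integral"
begin

text \<open>In polar coordinates the self-energy is \<open>e\<^sup>2 / 2\<close> times the integral over \<open>r \<ge> 0\<close> of
  \<open>r\<^sup>2 (\<Upsilon>\<^sub>2 - \<Upsilon>'\<^sub>1)\<^sup>2\<close>, and the three terms of the square are treated separately by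
  dominated convergence. Since \<open>\<Upsilon>\<^sub>2\<close> tends to \<open>r\<^sup>-\<^sup>2 H(r - a)\<close> with \<open>(1 + r\<^sup>2) \<bar>\<Upsilon>\<^sub>2\<bar>\<close> uniformly bounded,
  the first term tends to \<open>1 / a\<close>. The substitution \<open>r = a + \<epsilon> z\<close> turns the square of \<open>\<Upsilon>'\<^sub>1\<close> into
  \<open>M / \<epsilon> + o(1)\<close>, the term of order \<open>0\<close> being the integral of the odd function \<open>2 z \<eta>(z)\<^sup>2 / a\<close>.
  The mixed integral tends to \<open>1 / a\<close> times the integral of \<open>F \<eta>\<close>, where \<open>F\<close> is the primitive
  of \<open>\<eta>\<close> vanishing at \<open>-\<infinity>\<close>; as \<open>F(-z) = 1 - F(z)\<close>, this integral is \<open>1 / 2\<close>, and the finite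
  contributions \<open>1 / a - 2 / (2 a)\<close> cancel.\<close>

section \<open>Integration of radial functions\<close>

text \<open>A closed ball of radius s \<ge> 0 has volume V s^d, and V d r^(d-1) is the derivative of
  V r^d. The half-lines \<open>{..s}\<close> are closed under intersection and generate the Borel
  sets, and the sets \<open>{..real n}\<close> exhaust the line with finite measure, so the volumes
  of balls determine the push-forward.\<close>

lemma distr_lborel_norm:
  "distr (lborel :: 'a::euclidean_space measure) borel norm =
     density lborel (\<lambda>r. ennreal (indicator {0..} r *
       (unit_ball_vol (real DIM('a)) * (real DIM('a) * r ^ (DIM('a) - 1)))))"
    (is "?M = ?N")
proof (rule measure_eqI_generator_eq[where E = "range atMost" and \<Omega> = UNIV and A = "\<lambda>n. {..real n}"])
  fix X :: "real set" assume "X \<in> range atMost"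
  then obtain s where X: "X = {..s}" by auto
  let ?V = "unit_ball_vol (real DIM('a))"
  have V: "0 \<le> ?V" by (rule unit_ball_vol_nonneg) simp
  have "emeasure ?M X = emeasure lborel (cball (0::'a) s)"
    unfolding X by (subst emeasure_distr) (auto intro!: arg_cong2[where f = emeasure])
  moreover have "emeasure ?N X = emeasure lborel (cball (0::'a) s)"
  proof (cases "0 \<le> s")
    case True
    have "emeasure ?N X =
        (\<integral>\<^sup>+r. ennreal (?V * (real DIM('a) * r ^ (DIM('a) - 1))) * indicator {0..s} r \<partial>lborel)"
      unfolding X by (subst emeasure_density) (auto intro!: nn_integral_cong split: split_indicator)
    also have "\<dots> = ?V * s ^ DIM('a) - ?V * 0 ^ DIM('a)"
      using True V
      by (intro nn_integral_FTC_Icc[where F = "\<lambda>r. ?V * r ^ DIM('a)"])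
         (auto intro!: derivative_eq_intros mult_nonneg_nonneg)
    also have "\<dots> = emeasure lborel (cball (0::'a) s)"
      using True by (simp add: emeasure_cball)
    finally show ?thesis .
  next
    case False
    then have "emeasure ?N X = (\<integral>\<^sup>+r. 0 \<partial>(lborel :: real measure))"
      unfolding X
      by (subst emeasure_density, simp, simp, intro nn_integral_cong) (auto split: split_indicator)
    with False show ?thesis by simp
  qed
  ultimately show "emeasure ?M X = emeasure ?N X" by simp
next
  show "Int_stable (range (atMost :: real \<Rightarrow> _))"
    by (auto simp: Int_stable_def)
  show "sets ?M = sigma_sets UNIV (range atMost)" "sets ?N = sigma_sets UNIV (range atMost)"
    by (simp_all add: borel_eq_atMost)
  show "(\<Union>n. {..real n}) = UNIV"
    by (auto intro: real_arch_simple)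
  fix n :: nat
  have "emeasure ?M {..real n} = emeasure lborel (cball (0::'a) n)"
    by (subst emeasure_distr) (auto intro!: arg_cong2[where f = emeasure])
  then show "emeasure ?M {..real n} \<noteq> \<infinity>"
    by (simp add: emeasure_cball)
qed auto

lemma integral_norm_polar:
  fixes g :: "real \<Rightarrow> real"
  assumes [measurable]: "g \<in> borel_measurable borel"
  shows "(LINT x|(lborel :: 'a::euclidean_space measure). g (norm x)) =
    unit_ball_vol (real DIM('a)) * real DIM('a) *
      (LINT r|lborel. indicator {0..} r * r ^ (DIM('a) - 1) * g r)"
proof -
  have "(LINT x|(lborel :: 'a measure). g (norm x)) = (LINT r|distr (lborel :: 'a measure) borel norm. g r)"
    by (subst integral_distr) auto
  also have "\<dots> = (LINT r|lborel. unit_ball_vol (real DIM('a)) * real DIM('a) *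
      (indicator {0..} r * r ^ (DIM('a) - 1) * g r))"
    unfolding distr_lborel_norm
    by (subst integral_density)
       (auto simp: mult_ac unit_ball_vol_nonneg intro!: mult_nonneg_nonneg split: split_indicator)
  finally show ?thesis by simp
qed

section \<open>Dominated convergence for \<epsilon> tending to 0 from the right\<close>

text \<open>A limit at \<open>at_right 0\<close> can be tested along sequences in ]0,1[ that tend to
  0, which reduces the claim to the sequential theorem. Since domination is asked for only when
  \<epsilon> < 1, a power of \<epsilon> can be replaced by 1 in a majorant.\<close>

lemma integral_dominated_convergence_at_right_0:
  fixes s :: "real \<Rightarrow> 'a \<Rightarrow> 'b::{banach, second_countable_topology}"
  assumes meas: "f \<in> borel_measurable M"
      "\<And>\<epsilon>. 0 < \<epsilon> \<Longrightarrow> \<epsilon> < 1 \<Longrightarrow> s \<epsilon> \<in> borel_measurable M"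
    and w: "integrable M w"
    and lim: "AE x in M. ((\<lambda>\<epsilon>. s \<epsilon> x) \<longlongrightarrow> f x) (at_right 0)"
    and bound: "\<And>\<epsilon>. 0 < \<epsilon> \<Longrightarrow> \<epsilon> < 1 \<Longrightarrow> AE x in M. norm (s \<epsilon> x) \<le> w x"
  shows "((\<lambda>\<epsilon>. integral\<^sup>L M (s \<epsilon>)) \<longlongrightarrow> integral\<^sup>L M f) (at_right 0)"
proof (rule tendsto_at_right_sequentially[where b = 1])
  fix S :: "nat \<Rightarrow> real"
  assume S: "\<And>n. 0 < S n" "\<And>n. S n < 1" "S \<longlonglongrightarrow> 0"
  have "S n \<noteq> 0" for n
    using S(1)[of n] by simp
  with S have "filterlim S (at_right 0) sequentially"
    by (auto simp: filterlim_at)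
  then have "AE x in M. (\<lambda>n. s (S n) x) \<longlonglongrightarrow> f x"
    using lim by (auto elim!: eventually_mono intro: filterlim_compose)
  then show "(\<lambda>n. integral\<^sup>L M (s (S n))) \<longlonglongrightarrow> integral\<^sup>L M f"
    using meas w bound S by (intro integral_dominated_convergence[where w = w]) auto
qed simp

section \<open>The inverse square cut off at radius a\<close>

text \<open>This is y^-2 H(y - a), with the jump point y = a included, as in
  \<open>heaviside\<close>.\<close>

definition cut_inv_square :: "real \<Rightarrow> real \<Rightarrow> real" where
  "cut_inv_square a y = (if a \<le> y then 1 / y\<^sup>2 else 0)"

lemma borel_measurable_cut_inv_square [measurable]: "cut_inv_square a \<in> borel_measurable borel"
  unfolding cut_inv_square_def[abs_def] by measurable

lemma cut_inv_square_nonneg: "0 \<le> cut_inv_square a y"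
  by (simp add: cut_inv_square_def)

lemma cut_inv_square_le: "0 < a \<Longrightarrow> cut_inv_square a y \<le> 1 / a\<^sup>2"
  by (auto simp: cut_inv_square_def intro!: divide_left_mono power_mono)

lemma square_mult_cut_inv_square_le: "y\<^sup>2 * cut_inv_square a y \<le> 1"
  by (auto simp: cut_inv_square_def)

lemma isCont_cut_inv_square:
  assumes "0 < a" "r \<noteq> a"
  shows "isCont (cut_inv_square a) r"
proof (cases "a < r")
  case True
  have "\<forall>\<^sub>F y in nhds r. cut_inv_square a y = 1 / y\<^sup>2"
    using eventually_nhds_in_open[of "{a<..}" r] True
    by (auto simp: cut_inv_square_def elim!: eventually_mono)
  then show ?thesis
    using assms True by (subst isCont_cong) (auto intro!: continuous_intros)
next
  case False
  with assms have "r < a" by simp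
  then have "\<forall>\<^sub>F y in nhds r. cut_inv_square a y = 0"
    using eventually_nhds_in_open[of "{..<a}" r]
    by (auto simp: cut_inv_square_def elim!: eventually_mono)
  then show ?thesis
    by (subst isCont_cong) auto
qed

text \<open>For r \<ge> a the integrand is r^-2. Its primitive -1/r tends to 0 at infinity, whence
  the value in the form \<open>0 - - (1 / a)\<close>.\<close>

lemma integral_square_cut_inv_square:
  assumes "0 < a"
  shows "(LINT r|lborel. r\<^sup>2 * (cut_inv_square a r)\<^sup>2) = 1 / a"
proof -
  have "has_bochner_integral lborel (\<lambda>r. 1 / r\<^sup>2 * indicator {a..} r) (0 - - (1 / a))"
  proof (rule has_bochner_integral_nn_integral)
    have "(\<integral>\<^sup>+r. ennreal (1 / r\<^sup>2) * indicator {a..} r \<partial>lborel) = 0 - - (1 / a)"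
    proof (rule nn_integral_FTC_atLeast)
      show "((\<lambda>r. - (1 / r)) has_real_derivative 1 / x\<^sup>2) (at x)" if "a \<le> x" for x
        using assms that by (auto intro!: derivative_eq_intros simp: power2_eq_square)
      show "((\<lambda>r::real. - (1 / r)) \<longlongrightarrow> 0) at_top"
        by real_asymp
    qed auto
    moreover have "(\<integral>\<^sup>+r. ennreal (1 / r\<^sup>2 * indicator {a..} r) \<partial>lborel) =
        (\<integral>\<^sup>+r. ennreal (1 / r\<^sup>2) * indicator {a..} r \<partial>lborel)"
      by (intro nn_integral_cong) (auto split: split_indicator)
    ultimately show "(\<integral>\<^sup>+r. ennreal (1 / r\<^sup>2 * indicator {a..} r) \<partial>lborel) = ennreal (0 - - (1 / a))"
      by (rule trans[rotated])
  qed (use assms in auto)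
  then have "(LINT r|lborel. 1 / r\<^sup>2 * indicator {a..} r) = 1 / a"
    by (simp add: has_bochner_integral_iff)
  also have "(LINT r|lborel. 1 / r\<^sup>2 * indicator {a..} r) = (LINT r|lborel. r\<^sup>2 * (cut_inv_square a r)\<^sup>2)"
    using assms by (intro Bochner_Integration.integral_cong)
      (auto simp: cut_inv_square_def field_simps power2_eq_square split: split_indicator)
  finally show ?thesis .
qed

section \<open>Moments of Schwartz functions\<close>

lemma integrable_abs_bound:
  fixes f g :: "'a \<Rightarrow> real"
  assumes "integrable M g" "f \<in> borel_measurable M" "\<And>x. \<bar>f x\<bar> \<le> g x"
  shows "integrable M f"
  using assms by (intro Bochner_Integration.integrable_bound[of M g f])
    (auto intro!: AE_I2 order_trans[OF _ abs_ge_self])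

lemma integrable_inverse_1_plus_square_lborel:
  "integrable lborel (\<lambda>x::real. 1 / (1 + x\<^sup>2))"
  using integrable_inverse_1_plus_square
  by (simp add: set_integrable_def einterval_def inverse_eq_divide)

lemma schwartz_continuous: "schwartz f \<Longrightarrow> continuous_on UNIV f"
  unfolding schwartz_def
  by (metis continuous_at_imp_continuous_on differentiable_imp_continuous_within funpow_0)

lemma schwartz_bounded_moment:
  assumes "schwartz f"
  obtains C where "\<And>x. \<bar>x\<bar> ^ m * \<bar>f x\<bar> \<le> C"
proof -
  have "bounded (range (\<lambda>x. x ^ m * (deriv ^^ 0) f x))"
    using assms unfolding schwartz_def by blast
  then obtain C where "\<forall>x. \<bar>x ^ m * f x\<bar> \<le> C"
    by (auto simp: bounded_iff)
  then show ?thesis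
    by (intro that[of C]) (simp add: abs_mult power_abs)
qed

text \<open>The bounds for the powers m and m + 2 together bound (1 + x^2) |x|^m |f(x)|, so a
  multiple of 1/(1 + x^2) is an integrable majorant.\<close>

lemma schwartz_integrable_moment:
  assumes "schwartz f"
  shows "integrable lborel (\<lambda>x. \<bar>x\<bar> ^ m * \<bar>f x\<bar>)"
proof -
  note [measurable] = borel_measurable_continuous_onI[OF schwartz_continuous[OF assms]]
  obtain C where C: "\<bar>x\<bar> ^ m * \<bar>f x\<bar> \<le> C" for x
    using schwartz_bounded_moment[OF assms] by metis
  obtain D where D: "\<bar>x\<bar> ^ (m + 2) * \<bar>f x\<bar> \<le> D" for x
    using schwartz_bounded_moment[OF assms] by metis
  have "\<bar>x\<bar> ^ m * \<bar>f x\<bar> \<le> (C + D) * (1 / (1 + x\<^sup>2))" for x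
  proof -
    have "(1 + x\<^sup>2) * (\<bar>x\<bar> ^ m * \<bar>f x\<bar>) = \<bar>x\<bar> ^ m * \<bar>f x\<bar> + \<bar>x\<bar> ^ (m + 2) * \<bar>f x\<bar>"
      by (simp add: algebra_simps power_add power2_eq_square)
    also have "\<dots> \<le> C + D"
      using C D by (rule add_mono)
    finally show ?thesis
      by (simp add: field_simps add_pos_nonneg)
  qed
  then show ?thesis
    by (intro integrable_abs_bound[OF
        integrable_mult_right[OF integrable_inverse_1_plus_square_lborel, of "C + D"]])
       simp_all
qed

text \<open>A Schwartz function is bounded, so one factor of the square can be absorbed into a
  constant.\<close>

lemma schwartz_integrable_moment_square:
  assumes "schwartz f"
  shows "integrable lborel (\<lambda>x. \<bar>x\<bar> ^ m * (f x)\<^sup>2)"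
proof -
  note [measurable] = borel_measurable_continuous_onI[OF schwartz_continuous[OF assms]]
  obtain C where C: "\<bar>x\<bar> ^ 0 * \<bar>f x\<bar> \<le> C" for x
    using schwartz_bounded_moment[OF assms] by metis
  have "\<bar>x\<bar> ^ m * (f x)\<^sup>2 \<le> C * (\<bar>x\<bar> ^ m * \<bar>f x\<bar>)" for x
  proof -
    have "\<bar>x\<bar> ^ m * (f x)\<^sup>2 = \<bar>f x\<bar> * (\<bar>x\<bar> ^ m * \<bar>f x\<bar>)"
      by (simp add: power2_eq_square)
    also have "\<dots> \<le> C * (\<bar>x\<bar> ^ m * \<bar>f x\<bar>)"
      using C[of x] by (intro mult_right_mono) auto
    finally show ?thesis .
  qed
  then show ?thesis
    by (intro integrable_abs_bound[OF
        integrable_mult_right[OF schwartz_integrable_moment[OF assms], of C m]])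
       simp_all
qed

section \<open>The regularized inverse square: uniform decay and limits\<close>

locale mollified_charge =
  fixes \<eta> :: "real \<Rightarrow> real" and a :: real
  assumes mollifier: "mollifier \<eta>" and a_pos: "0 < a"
begin

lemma schwartz: "schwartz \<eta>"
  and even: "\<eta> (- z) = \<eta> z"
  and integral_eq_1: "(LINT z|lborel. \<eta> z) = 1"
  using mollifier by (auto simp: mollifier_def)

lemma borel_measurable [measurable]: "\<eta> \<in> borel_measurable borel"
  by (rule borel_measurable_continuous_onI[OF schwartz_continuous[OF schwartz]])

lemma integrable_abs: "integrable lborel (\<lambda>z. \<bar>\<eta> z\<bar>)"
  using schwartz_integrable_moment[OF schwartz, of 0] by simp

lemma integrable_mult_bounded:
  assumes [measurable]: "h \<in> borel_measurable borel" and h: "\<And>z. \<bar>h z\<bar> \<le> C"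
  shows "integrable lborel (\<lambda>z. h z * \<eta> z)"
  using h by (intro integrable_abs_bound[OF integrable_mult_right[OF integrable_abs, of C]])
    (simp_all add: abs_mult mult_right_mono)

text \<open>The lower limit of integration depends on r and \<epsilon>; moving it into the integrand
  leaves a fixed domain, as dominated convergence requires.\<close>

lemma Upsilon_2_eq:
  assumes "0 < \<epsilon>"
  shows "Upsilon \<eta> a \<epsilon> 2 r = (LINT z|lborel. cut_inv_square a (r + \<epsilon> * z) * \<eta> z)"
  unfolding Upsilon_eq[OF assms] set_lebesgue_integral_def using assms
  by (intro Bochner_Integration.integral_cong)
     (auto simp: cut_inv_square_def field_simps split: split_indicator)

lemma borel_measurable_Upsilon_2 [measurable]:
  assumes "0 < \<epsilon>"
  shows "Upsilon \<eta> a \<epsilon> 2 \<in> borel_measurable borel"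
proof -
  have "Upsilon \<eta> a \<epsilon> 2 = (\<lambda>r. LINT z|lborel. cut_inv_square a (r + \<epsilon> * z) * \<eta> z)"
    using assms by (intro ext) (rule Upsilon_2_eq)
  then show ?thesis by simp
qed

lemma borel_measurable_Upsilon'_1 [measurable]:
  "Upsilon' \<eta> a \<epsilon> 1 \<in> borel_measurable borel"
  unfolding Upsilon'_eq[abs_def] by measurable

text \<open>The quadratic decay of the cut-off function survives averaging against \<eta>: the shift
  by \<epsilon> z costs at most a multiple of z^2, and \<eta> has a finite absolute second moment.
  Uniformity in r makes the bound usable at points that move with \<epsilon>.\<close>

lemma Upsilon_2_bound:
  obtains C where "\<And>\<epsilon> r. 0 < \<epsilon> \<Longrightarrow> \<epsilon> < 1 \<Longrightarrow> (1 + r\<^sup>2) * \<bar>Upsilon \<eta> a \<epsilon> 2 r\<bar> \<le> C"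
proof
  fix \<epsilon> r :: real assume \<epsilon>: "0 < \<epsilon>" "\<epsilon> < 1"
  let ?k = "\<lambda>z. cut_inv_square a (r + \<epsilon> * z)"
  \<comment> \<open>The witness C is the integral of \<open>?w\<close>, which contains neither r nor
    \<epsilon>.\<close>
  let ?w = "\<lambda>z. (2 + 1 / a\<^sup>2) * \<bar>\<eta> z\<bar> + 2 / a\<^sup>2 * (\<bar>z\<bar>\<^sup>2 * \<bar>\<eta> z\<bar>)"
  have bound: "(1 + r\<^sup>2) * ?k z \<le> (2 + 1 / a\<^sup>2) + 2 / a\<^sup>2 * \<bar>z\<bar>\<^sup>2" for z
  proof -
    \<comment> \<open>The right side minus the left side is (r + 2 \<epsilon> z)^2.\<close>
    have "r\<^sup>2 \<le> 2 * (r + \<epsilon> * z)\<^sup>2 + 2 * (\<epsilon> * z)\<^sup>2"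
      using zero_le_power2[of "r + 2 * \<epsilon> * z"] by (simp add: power2_eq_square algebra_simps)
    also have "(\<epsilon> * z)\<^sup>2 \<le> \<bar>z\<bar>\<^sup>2"
      using \<epsilon> by (simp add: power_mult_distrib mult_left_le_one_le power_le_one)
    finally have "(1 + r\<^sup>2) * ?k z \<le> (1 + 2 * (r + \<epsilon> * z)\<^sup>2 + 2 * \<bar>z\<bar>\<^sup>2) * ?k z"
      by (intro mult_right_mono) (auto simp: cut_inv_square_nonneg)
    also have "\<dots> = 2 * ((r + \<epsilon> * z)\<^sup>2 * ?k z) + (1 + 2 * \<bar>z\<bar>\<^sup>2) * ?k z"
      by (simp add: algebra_simps)
    also have "\<dots> \<le> 2 * 1 + (1 + 2 * \<bar>z\<bar>\<^sup>2) * (1 / a\<^sup>2)"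
      by (intro add_mono mult_left_mono square_mult_cut_inv_square_le cut_inv_square_le a_pos) auto
    finally show ?thesis by (simp add: algebra_simps)
  qed
  have "(1 + r\<^sup>2) * \<bar>Upsilon \<eta> a \<epsilon> 2 r\<bar> = \<bar>LINT z|lborel. (1 + r\<^sup>2) * ?k z * \<eta> z\<bar>"
    using \<epsilon> by (simp add: Upsilon_2_eq abs_mult mult.assoc)
  also have "\<dots> \<le> (LINT z|lborel. ?w z)"
  proof (rule integral_abs_bound_integral)
    show "integrable lborel (\<lambda>z. (1 + r\<^sup>2) * ?k z * \<eta> z)"
      using mult_left_mono[OF cut_inv_square_le[OF a_pos], of "1 + r\<^sup>2"]
      by (intro integrable_mult_bounded[where C = "(1 + r\<^sup>2) * (1 / a\<^sup>2)"])
         (simp_all add: abs_mult cut_inv_square_nonneg)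
    show "integrable lborel ?w"
      using schwartz_integrable_moment[OF schwartz, of 2] integrable_abs by simp
    fix z
    have "\<bar>(1 + r\<^sup>2) * ?k z * \<eta> z\<bar> = (1 + r\<^sup>2) * ?k z * \<bar>\<eta> z\<bar>"
      by (simp add: abs_mult cut_inv_square_nonneg)
    also have "\<dots> \<le> ((2 + 1 / a\<^sup>2) + 2 / a\<^sup>2 * \<bar>z\<bar>\<^sup>2) * \<bar>\<eta> z\<bar>"
      by (intro mult_right_mono bound) simp
    finally show "\<bar>(1 + r\<^sup>2) * ?k z * \<eta> z\<bar> \<le> ?w z"
      by (simp add: algebra_simps)
  qed
  finally show "(1 + r\<^sup>2) * \<bar>Upsilon \<eta> a \<epsilon> 2 r\<bar> \<le> (LINT z|lborel. ?w z)" .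
qed

text \<open>The point r may move with \<epsilon>, so that one argument serves both a fixed r off the
  jump and the blow-up r = a + \<epsilon> z. The majorant is |\<eta>|/a^2, because the cut-off
  function never exceeds 1/a^2.\<close>

lemma tendsto_Upsilon_2I:
  assumes f: "f \<in> borel_measurable borel"
    and lim: "\<And>z. ((\<lambda>\<epsilon>. cut_inv_square a (r \<epsilon> + \<epsilon> * z)) \<longlongrightarrow> f z) (at_right 0)"
  shows "((\<lambda>\<epsilon>. Upsilon \<eta> a \<epsilon> 2 (r \<epsilon>)) \<longlongrightarrow> (LINT z|lborel. f z * \<eta> z)) (at_right 0)"
proof -
  note [measurable] = f
  have "((\<lambda>\<epsilon>. LINT z|lborel. cut_inv_square a (r \<epsilon> + \<epsilon> * z) * \<eta> z) \<longlongrightarrow>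
      (LINT z|lborel. f z * \<eta> z)) (at_right 0)"
  proof (rule integral_dominated_convergence_at_right_0)
    show "integrable lborel (\<lambda>z. 1 / a\<^sup>2 * \<bar>\<eta> z\<bar>)"
      using integrable_abs by simp
    show "AE z in lborel. ((\<lambda>\<epsilon>. cut_inv_square a (r \<epsilon> + \<epsilon> * z) * \<eta> z) \<longlongrightarrow> f z * \<eta> z) (at_right 0)"
      by (intro AE_I2 tendsto_mult lim tendsto_const)
    fix \<epsilon> :: real
    have "norm (cut_inv_square a (r \<epsilon> + \<epsilon> * z) * \<eta> z) \<le> 1 / a\<^sup>2 * \<bar>\<eta> z\<bar>" for z
      using mult_right_mono[OF cut_inv_square_le[OF a_pos], of "\<bar>\<eta> z\<bar>"]
      by (simp add: abs_mult cut_inv_square_nonneg)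
    then show "AE z in lborel. norm (cut_inv_square a (r \<epsilon> + \<epsilon> * z) * \<eta> z) \<le> 1 / a\<^sup>2 * \<bar>\<eta> z\<bar>"
      by simp
  qed simp_all
  moreover have "\<forall>\<^sub>F \<epsilon> in at_right 0. (LINT z|lborel. cut_inv_square a (r \<epsilon> + \<epsilon> * z) * \<eta> z) =
      Upsilon \<eta> a \<epsilon> 2 (r \<epsilon>)"
    by (intro eventually_mono[OF eventually_at_right_less]) (simp add: Upsilon_2_eq)
  ultimately show ?thesis
    by (rule Lim_transform_eventually)
qed

lemma tendsto_Upsilon_2:
  assumes "r \<noteq> a"
  shows "((\<lambda>\<epsilon>. Upsilon \<eta> a \<epsilon> 2 r) \<longlongrightarrow> cut_inv_square a r) (at_right 0)"
proof -
  have "((\<lambda>\<epsilon>. Upsilon \<eta> a \<epsilon> 2 r) \<longlongrightarrow> (LINT z|lborel. cut_inv_square a r * \<eta> z)) (at_right 0)"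
  proof (rule tendsto_Upsilon_2I)
    fix z
    have "((\<lambda>\<epsilon>. r + \<epsilon> * z) \<longlongrightarrow> r + 0 * z) (at_right 0)"
      by (intro tendsto_intros)
    then show "((\<lambda>\<epsilon>. cut_inv_square a (r + \<epsilon> * z)) \<longlongrightarrow> cut_inv_square a r) (at_right 0)"
      by (intro isCont_tendsto_compose[OF isCont_cut_inv_square[OF a_pos assms]]) simp
  qed simp
  then show ?thesis
    by (simp add: integral_eq_1)
qed

section \<open>The primitive of the mollifier and the profile of the jump\<close>

text \<open>This is the integral of \<eta> from -z to infinity, which by evenness is the primitive
  of \<eta> vanishing at minus infinity. The indicator form is the one that the rescaled
  \<open>Upsilon\<close> produces in the limit.\<close>

definition cumulative :: "real \<Rightarrow> real" where
  "cumulative z = (LINT w|lborel. indicator {0..} (z + w) * \<eta> w)"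

lemma borel_measurable_cumulative [measurable]: "cumulative \<in> borel_measurable borel"
  unfolding cumulative_def[abs_def] by measurable

lemma integrable_cumulative_integrand:
  "integrable lborel (\<lambda>w. indicator {0..} (z + w) * \<eta> w)"
  by (rule integrable_mult_bounded[where C = 1]) (auto split: split_indicator)

lemma cumulative_bound: "\<bar>cumulative z\<bar> \<le> (LINT w|lborel. \<bar>\<eta> w\<bar>)"
  unfolding cumulative_def
  by (rule integral_abs_bound_integral[OF integrable_cumulative_integrand integrable_abs])
     (auto split: split_indicator)

text \<open>After the reflection of w, the two integrals run over w \<le> -z and w \<ge> -z. These
  half-lines share only the null set {-z}, so the integrals add up to the total mass 1.\<close>

lemma cumulative_minus: "cumulative (- z) = 1 - cumulative z"
proof -
  have "cumulative (- z) = (LINT w|lborel. indicator {0..} (- z - w) * \<eta> w)"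
    unfolding cumulative_def
    by (subst lborel_integral_real_affine[where c = "-1" and t = 0]) (simp_all add: even)
  also have "\<dots> = (LINT w|lborel. \<eta> w - indicator {0..} (z + w) * \<eta> w)"
    using AE_lborel_singleton[of "- z"]
    by (intro integral_cong_AE) (auto split: split_indicator)
  also have "\<dots> = 1 - cumulative z"
    unfolding cumulative_def integral_eq_1[symmetric]
    using integrable_mult_bounded[of "\<lambda>_. 1" 1]
    by (intro Bochner_Integration.integral_diff integrable_cumulative_integrand) simp
  finally show ?thesis .
qed

text \<open>Reflection of z turns the integral I into 1 - I, so no derivative of
  \<open>cumulative\<close> has to be taken.\<close>

lemma integral_cumulative: "(LINT z|lborel. cumulative z * \<eta> z) = 1 / 2"
proof -
  have int: "integrable lborel (\<lambda>z. cumulative z * \<eta> z)"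
    by (rule integrable_mult_bounded[OF _ cumulative_bound]) simp
  have int': "integrable lborel \<eta>"
    using integrable_mult_bounded[of "\<lambda>_. 1" 1] by simp
  have "(LINT z|lborel. cumulative z * \<eta> z) = (LINT z|lborel. cumulative (- z) * \<eta> (- z))"
    by (subst lborel_integral_real_affine[where c = "-1" and t = 0]) simp_all
  also have "\<dots> = (LINT z|lborel. \<eta> z - cumulative z * \<eta> z)"
    by (simp add: even cumulative_minus algebra_simps)
  also have "\<dots> = 1 - (LINT z|lborel. cumulative z * \<eta> z)"
    using int int' by (simp add: integral_eq_1)
  finally show ?thesis by simp
qed

text \<open>At r = a + \<epsilon> z the kernel is evaluated at a + \<epsilon> (z + w). Whether this
  point lies beyond the jump depends only on the sign of z + w, so \<epsilon> acts only through the
  continuous factor, which tends to 1/a^2.\<close>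

lemma tendsto_Upsilon_2_scaled:
  "((\<lambda>\<epsilon>. Upsilon \<eta> a \<epsilon> 2 (a + \<epsilon> * z)) \<longlongrightarrow> cumulative z / a\<^sup>2) (at_right 0)"
proof -
  have "((\<lambda>\<epsilon>. Upsilon \<eta> a \<epsilon> 2 (a + \<epsilon> * z)) \<longlongrightarrow>
      (LINT w|lborel. (indicator {0..} (z + w) / a\<^sup>2) * \<eta> w)) (at_right 0)"
  proof (rule tendsto_Upsilon_2I)
    fix w
    have "((\<lambda>\<epsilon>. indicator {0..} (z + w) / (a + \<epsilon> * (z + w))\<^sup>2) \<longlongrightarrow>
        indicator {0..} (z + w) / (a + 0 * (z + w))\<^sup>2) (at_right 0)"
      using a_pos by (intro tendsto_intros) auto
    moreover have "\<forall>\<^sub>F \<epsilon> in at_right 0. indicator {0..} (z + w) / (a + \<epsilon> * (z + w))\<^sup>2 =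
        cut_inv_square a (a + \<epsilon> * z + \<epsilon> * w)"
    proof (intro eventually_mono[OF eventually_at_right_less])
      fix \<epsilon> :: real assume "0 < \<epsilon>"
      then have "a \<le> a + \<epsilon> * z + \<epsilon> * w \<longleftrightarrow> 0 \<le> z + w"
        by (simp add: add.assoc zero_le_mult_iff flip: distrib_left)
      then show "indicator {0..} (z + w) / (a + \<epsilon> * (z + w))\<^sup>2 = cut_inv_square a (a + \<epsilon> * z + \<epsilon> * w)"
        by (simp add: cut_inv_square_def distrib_left add.assoc)
    qed
    ultimately show "((\<lambda>\<epsilon>. cut_inv_square a (a + \<epsilon> * z + \<epsilon> * w)) \<longlongrightarrow>
        indicator {0..} (z + w) / a\<^sup>2) (at_right 0)"
      by (simp add: Lim_transform_eventually)
  qed simp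
  then show ?thesis
    by (simp add: cumulative_def)
qed

section \<open>The square of the regularized inverse square\<close>

text \<open>Replacing r^2 by 1 + r^2 makes (1 + r^2) times the left side at most the square of the
  quantity bounded in \<open>Upsilon_2_bound\<close>.\<close>

lemma square_mult_Upsilon_2_bound:
  obtains C where "\<And>\<epsilon> r. 0 < \<epsilon> \<Longrightarrow> \<epsilon> < 1 \<Longrightarrow> r\<^sup>2 * (Upsilon \<eta> a \<epsilon> 2 r)\<^sup>2 \<le> C * (1 / (1 + r\<^sup>2))"
proof -
  obtain C where C: "\<And>\<epsilon> r. 0 < \<epsilon> \<Longrightarrow> \<epsilon> < 1 \<Longrightarrow> (1 + r\<^sup>2) * \<bar>Upsilon \<eta> a \<epsilon> 2 r\<bar> \<le> C"
    using Upsilon_2_bound by blast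
  show thesis
  proof (rule that[of "C\<^sup>2"])
    fix \<epsilon> r :: real assume \<epsilon>: "0 < \<epsilon>" "\<epsilon> < 1"
    let ?u = "Upsilon \<eta> a \<epsilon> 2 r"
    have "(1 + r\<^sup>2) * (r\<^sup>2 * ?u\<^sup>2) \<le> (1 + r\<^sup>2) * ((1 + r\<^sup>2) * ?u\<^sup>2)"
      by (intro mult_left_mono mult_right_mono) auto
    also have "\<dots> = ((1 + r\<^sup>2) * \<bar>?u\<bar>)\<^sup>2"
      by (simp add: power_mult_distrib power2_eq_square)
    also have "\<dots> \<le> C\<^sup>2"
      using C[OF \<epsilon>, of r] by (intro power_mono) auto
    finally show "r\<^sup>2 * ?u\<^sup>2 \<le> C\<^sup>2 * (1 / (1 + r\<^sup>2))"
      by (simp add: field_simps add_pos_nonneg)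
  qed
qed

lemma integrable_Upsilon_2_square:
  assumes "0 < \<epsilon>" "\<epsilon> < 1"
  shows "integrable lborel (\<lambda>r. indicator {0..} r * r\<^sup>2 * (Upsilon \<eta> a \<epsilon> 2 r)\<^sup>2)"
proof -
  obtain C where C: "\<And>r. r\<^sup>2 * (Upsilon \<eta> a \<epsilon> 2 r)\<^sup>2 \<le> C * (1 / (1 + r\<^sup>2))"
    using square_mult_Upsilon_2_bound assms by metis
  \<comment> \<open>For r < 0 the indicator annihilates the integrand, and there the majorant has to
    be nonnegative by itself.\<close>
  have "0 \<le> C * (1 / (1 + r\<^sup>2))" for r
    by (rule order_trans[OF _ C[of r]]) simp
  with C assms show ?thesis
    by (intro integrable_abs_bound[OF integrable_mult_right[OF
          integrable_inverse_1_plus_square_lborel, of C]])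
       (auto simp: abs_mult split: split_indicator)
qed

lemma tendsto_integral_Upsilon_2_square:
  "((\<lambda>\<epsilon>. LINT r|lborel. indicator {0..} r * r\<^sup>2 * (Upsilon \<eta> a \<epsilon> 2 r)\<^sup>2) \<longlongrightarrow> 1 / a) (at_right 0)"
proof -
  obtain C where C: "\<And>\<epsilon> r. 0 < \<epsilon> \<Longrightarrow> \<epsilon> < 1 \<Longrightarrow> r\<^sup>2 * (Upsilon \<eta> a \<epsilon> 2 r)\<^sup>2 \<le> C * (1 / (1 + r\<^sup>2))"
    using square_mult_Upsilon_2_bound by blast
  have "((\<lambda>\<epsilon>. LINT r|lborel. indicator {0..} r * r\<^sup>2 * (Upsilon \<eta> a \<epsilon> 2 r)\<^sup>2) \<longlongrightarrow>
      (LINT r|lborel. r\<^sup>2 * (cut_inv_square a r)\<^sup>2)) (at_right 0)"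
  proof (rule integral_dominated_convergence_at_right_0)
    show "integrable lborel (\<lambda>r. C * (1 / (1 + r\<^sup>2)))"
      by (rule integrable_mult_right[OF integrable_inverse_1_plus_square_lborel])
    have "((\<lambda>\<epsilon>. indicator {0..} r * r\<^sup>2 * (Upsilon \<eta> a \<epsilon> 2 r)\<^sup>2) \<longlongrightarrow> r\<^sup>2 * (cut_inv_square a r)\<^sup>2)
        (at_right 0)" if "r \<noteq> a" for r
    proof -
      have "((\<lambda>\<epsilon>. indicator {0..} r * r\<^sup>2 * (Upsilon \<eta> a \<epsilon> 2 r)\<^sup>2) \<longlongrightarrow>
          indicator {0..} r * r\<^sup>2 * (cut_inv_square a r)\<^sup>2) (at_right 0)"
        by (intro tendsto_intros tendsto_Upsilon_2 that)
      \<comment> \<open>The limit vanishes for r < a, hence for all negative r.\<close>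
      also have "indicator {0..} r * r\<^sup>2 * (cut_inv_square a r)\<^sup>2 = r\<^sup>2 * (cut_inv_square a r)\<^sup>2"
        using a_pos by (auto simp: cut_inv_square_def split: split_indicator)
      finally show ?thesis .
    qed
    then show "AE r in lborel. ((\<lambda>\<epsilon>. indicator {0..} r * r\<^sup>2 * (Upsilon \<eta> a \<epsilon> 2 r)\<^sup>2) \<longlongrightarrow>
        r\<^sup>2 * (cut_inv_square a r)\<^sup>2) (at_right 0)"
      using AE_lborel_singleton[of a] by (rule eventually_mono[rotated])
    fix \<epsilon> :: real assume \<epsilon>: "0 < \<epsilon>" "\<epsilon> < 1"
    have "norm (indicator {0..} r * r\<^sup>2 * (Upsilon \<eta> a \<epsilon> 2 r)\<^sup>2) \<le> C * (1 / (1 + r\<^sup>2))" for r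
    proof -
      have "norm (indicator {0..} r * r\<^sup>2 * (Upsilon \<eta> a \<epsilon> 2 r)\<^sup>2) \<le> r\<^sup>2 * (Upsilon \<eta> a \<epsilon> 2 r)\<^sup>2"
        by (auto simp: abs_mult split: split_indicator)
      also note C[OF \<epsilon>]
      finally show ?thesis .
    qed
    then show "AE r in lborel. norm (indicator {0..} r * r\<^sup>2 * (Upsilon \<eta> a \<epsilon> 2 r)\<^sup>2) \<le> C * (1 / (1 + r\<^sup>2))"
      by simp
  qed simp_all
  then show ?thesis
    by (simp add: integral_square_cut_inv_square[OF a_pos])
qed

section \<open>The mixed term\<close>

lemma Upsilon'_1_scaled: "0 < \<epsilon> \<Longrightarrow> Upsilon' \<eta> a \<epsilon> 1 (a + \<epsilon> * z) = \<eta> z / (a * \<epsilon>)"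
  by (simp add: Upsilon'_eq even)

text \<open>The regularized delta is concentrated on the scale \<epsilon> around a, the same scale
  on which \<open>Upsilon\<close> crosses its jump, so separate limits do not determine the product.
  With r = a + \<epsilon> z both profiles become fixed: \<eta>(z), and
  \<open>cumulative z / a\<^sup>2\<close>, whose denominator is cancelled by the limit of
  r^2.\<close>

lemma tendsto_integral_Upsilon_2_Upsilon'_1:
  "((\<lambda>\<epsilon>. LINT r|lborel. indicator {0..} r * r\<^sup>2 * (Upsilon \<eta> a \<epsilon> 2 r * Upsilon' \<eta> a \<epsilon> 1 r))
     \<longlongrightarrow> 1 / (2 * a)) (at_right 0)"
proof -
  obtain C where C: "\<And>\<epsilon> r. 0 < \<epsilon> \<Longrightarrow> \<epsilon> < 1 \<Longrightarrow> (1 + r\<^sup>2) * \<bar>Upsilon \<eta> a \<epsilon> 2 r\<bar> \<le> C"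
    using Upsilon_2_bound by blast
  let ?h = "\<lambda>\<epsilon> z. indicator {0..} (a + \<epsilon> * z) * (a + \<epsilon> * z)\<^sup>2 * Upsilon \<eta> a \<epsilon> 2 (a + \<epsilon> * z)"
  have "((\<lambda>\<epsilon>. LINT z|lborel. ?h \<epsilon> z * \<eta> z) \<longlongrightarrow> (LINT z|lborel. cumulative z * \<eta> z)) (at_right 0)"
  proof (rule integral_dominated_convergence_at_right_0)
    show "integrable lborel (\<lambda>z. C * \<bar>\<eta> z\<bar>)"
      using integrable_abs by simp
    have "((\<lambda>\<epsilon>. ?h \<epsilon> z) \<longlongrightarrow> cumulative z) (at_right 0)" for z
    proof -
      have lim: "((\<lambda>\<epsilon>. a + \<epsilon> * z) \<longlongrightarrow> a) (at_right 0)"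
        by (auto intro!: tendsto_eq_intros)
      have "((\<lambda>\<epsilon>. (a + \<epsilon> * z)\<^sup>2 * Upsilon \<eta> a \<epsilon> 2 (a + \<epsilon> * z)) \<longlongrightarrow> a\<^sup>2 * (cumulative z / a\<^sup>2)) (at_right 0)"
        by (intro tendsto_intros lim tendsto_Upsilon_2_scaled)
      \<comment> \<open>For fixed z the point a + \<epsilon> z is eventually positive, so the
        indicator becomes 1.\<close>
      moreover have "\<forall>\<^sub>F \<epsilon> in at_right 0. (a + \<epsilon> * z)\<^sup>2 * Upsilon \<eta> a \<epsilon> 2 (a + \<epsilon> * z) = ?h \<epsilon> z"
        using order_tendstoD(1)[OF lim a_pos] by (rule eventually_mono) simp
      ultimately show ?thesis
        using a_pos by (simp add: Lim_transform_eventually)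
    qed
    then show "AE z in lborel. ((\<lambda>\<epsilon>. ?h \<epsilon> z * \<eta> z) \<longlongrightarrow> cumulative z * \<eta> z) (at_right 0)"
      by (intro AE_I2 tendsto_mult tendsto_const)
    fix \<epsilon> :: real assume \<epsilon>: "0 < \<epsilon>" "\<epsilon> < 1"
    show "(\<lambda>z. ?h \<epsilon> z * \<eta> z) \<in> borel_measurable lborel"
      using \<epsilon>(1) by simp
    have "norm (?h \<epsilon> z * \<eta> z) \<le> C * \<bar>\<eta> z\<bar>" for z
    proof -
      have "\<bar>?h \<epsilon> z\<bar> \<le> (1 + (a + \<epsilon> * z)\<^sup>2) * \<bar>Upsilon \<eta> a \<epsilon> 2 (a + \<epsilon> * z)\<bar>"
        unfolding abs_mult by (intro mult_right_mono) (auto split: split_indicator)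
      also note C[OF \<epsilon>]
      finally show ?thesis
        unfolding real_norm_def abs_mult[of _ "\<eta> z"] by (intro mult_right_mono) auto
    qed
    then show "AE z in lborel. norm (?h \<epsilon> z * \<eta> z) \<le> C * \<bar>\<eta> z\<bar>"
      by simp
  qed simp
  then have "((\<lambda>\<epsilon>. (LINT z|lborel. ?h \<epsilon> z * \<eta> z) / a) \<longlongrightarrow> 1 / 2 / a) (at_right 0)"
    unfolding integral_cumulative using a_pos by (intro tendsto_intros) auto
  moreover have "\<forall>\<^sub>F \<epsilon> in at_right 0. (LINT z|lborel. ?h \<epsilon> z * \<eta> z) / a =
      (LINT r|lborel. indicator {0..} r * r\<^sup>2 * (Upsilon \<eta> a \<epsilon> 2 r * Upsilon' \<eta> a \<epsilon> 1 r))"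
  proof (intro eventually_mono[OF eventually_at_right_less])
    fix \<epsilon> :: real assume \<epsilon>: "0 < \<epsilon>"
    \<comment> \<open>The Jacobian \<epsilon> cancels the factor 1/\<epsilon> of the regularized
      delta; only 1/a remains.\<close>
    then have "(LINT r|lborel. indicator {0..} r * r\<^sup>2 * (Upsilon \<eta> a \<epsilon> 2 r * Upsilon' \<eta> a \<epsilon> 1 r)) =
        \<epsilon> * (LINT z|lborel. ?h \<epsilon> z * \<eta> z / (a * \<epsilon>))"
      by (subst lborel_integral_real_affine[where c = \<epsilon> and t = a])
         (simp_all add: Upsilon'_1_scaled mult.assoc del: One_nat_def)
    also have "\<dots> = (LINT z|lborel. ?h \<epsilon> z * \<eta> z) / a"
      using \<epsilon> by simp
    finally show "(LINT z|lborel. ?h \<epsilon> z * \<eta> z) / a =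
      (LINT r|lborel. indicator {0..} r * r\<^sup>2 * (Upsilon \<eta> a \<epsilon> 2 r * Upsilon' \<eta> a \<epsilon> 1 r))" ..
  qed
  ultimately show ?thesis
    by (simp add: Lim_transform_eventually)
qed

section \<open>The square of the regularized delta\<close>

lemma scaled_Upsilon'_1_square:
  assumes "0 < \<epsilon>"
  shows "indicator {0..} (a + \<epsilon> * z) * (a + \<epsilon> * z)\<^sup>2 * (Upsilon' \<eta> a \<epsilon> 1 (a + \<epsilon> * z))\<^sup>2 =
    indicator {0..} (a + \<epsilon> * z) * (a + \<epsilon> * z)\<^sup>2 * (\<eta> z)\<^sup>2 / (a * \<epsilon>)\<^sup>2"
  unfolding Upsilon'_1_scaled[OF assms] by (simp add: power_divide)

text \<open>In the variable z the weight r^2 grows at most quadratically, so the moments of \<eta>^2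
  of orders 0 and 2 give a majorant; integrability is then carried back to r.\<close>

lemma integrable_Upsilon'_1_square:
  assumes "0 < \<epsilon>"
  shows "integrable lborel (\<lambda>r. indicator {0..} r * r\<^sup>2 * (Upsilon' \<eta> a \<epsilon> 1 r)\<^sup>2)"
proof -
  have "integrable lborel (\<lambda>z. (2 * a\<^sup>2 * (\<bar>z\<bar> ^ 0 * (\<eta> z)\<^sup>2) + 2 * \<epsilon>\<^sup>2 * (\<bar>z\<bar> ^ 2 * (\<eta> z)\<^sup>2)) / (a * \<epsilon>)\<^sup>2)"
    by (intro Bochner_Integration.integrable_add integrable_mult_right integrable_divide
        schwartz_integrable_moment_square schwartz)
  then have "integrable lborel (\<lambda>z. indicator {0..} (a + \<epsilon> * z) * (a + \<epsilon> * z)\<^sup>2 * (\<eta> z)\<^sup>2 / (a * \<epsilon>)\<^sup>2)"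
  proof (rule integrable_abs_bound)
    fix z
    \<comment> \<open>The right side minus the left side is (a - \<epsilon> z)^2.\<close>
    have "(a + \<epsilon> * z)\<^sup>2 \<le> 2 * a\<^sup>2 + 2 * \<epsilon>\<^sup>2 * z\<^sup>2"
      using zero_le_power2[of "a - \<epsilon> * z"] by (simp add: power2_eq_square algebra_simps)
    then have "indicator {0..} (a + \<epsilon> * z) * (a + \<epsilon> * z)\<^sup>2 \<le> 2 * a\<^sup>2 + 2 * \<epsilon>\<^sup>2 * z\<^sup>2"
      by (auto split: split_indicator)
    then have "indicator {0..} (a + \<epsilon> * z) * (a + \<epsilon> * z)\<^sup>2 * (\<eta> z)\<^sup>2 / (a * \<epsilon>)\<^sup>2 \<le>
        (2 * a\<^sup>2 + 2 * \<epsilon>\<^sup>2 * z\<^sup>2) * (\<eta> z)\<^sup>2 / (a * \<epsilon>)\<^sup>2"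
      by (intro divide_right_mono mult_right_mono) auto
    then show "\<bar>indicator {0..} (a + \<epsilon> * z) * (a + \<epsilon> * z)\<^sup>2 * (\<eta> z)\<^sup>2 / (a * \<epsilon>)\<^sup>2\<bar> \<le>
        (2 * a\<^sup>2 * (\<bar>z\<bar> ^ 0 * (\<eta> z)\<^sup>2) + 2 * \<epsilon>\<^sup>2 * (\<bar>z\<bar> ^ 2 * (\<eta> z)\<^sup>2)) / (a * \<epsilon>)\<^sup>2"
      by (simp add: abs_mult algebra_simps)
  qed simp
  then have "integrable lborel (\<lambda>z. indicator {0..} (a + \<epsilon> * z) * (a + \<epsilon> * z)\<^sup>2 *
      (Upsilon' \<eta> a \<epsilon> 1 (a + \<epsilon> * z))\<^sup>2)"
    unfolding scaled_Upsilon'_1_square[OF assms] .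
  then show ?thesis
    using assms by (subst (asm) lborel_integrable_real_affine_iff) auto
qed

text \<open>Both terms are of order 1/\<epsilon>, so they are subtracted under the integral sign
  before the limit is taken. The limiting integrand is odd, and its integral vanishes.\<close>

lemma tendsto_integral_Upsilon'_1_square:
  "((\<lambda>\<epsilon>. (LINT r|lborel. indicator {0..} r * r\<^sup>2 * (Upsilon' \<eta> a \<epsilon> 1 r)\<^sup>2) -
      (LINT z|lborel. (\<eta> z)\<^sup>2) / \<epsilon>) \<longlongrightarrow> 0) (at_right 0)"
proof -
  \<comment> \<open>This is the coefficient of \<eta>(z)^2 in the merged integral. Where the
    indicator is 1, the terms 1/\<epsilon> cancel; elsewhere the coefficient is
    -1/\<epsilon>.\<close>
  let ?i = "\<lambda>\<epsilon> z. indicator {0..} (a + \<epsilon> * z) * (a + \<epsilon> * z)\<^sup>2 / (a\<^sup>2 * \<epsilon>) - 1 / \<epsilon>"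
  have int: "integrable lborel (\<lambda>z. (\<eta> z)\<^sup>2)"
    using schwartz_integrable_moment_square[OF schwartz, of 0] by simp
  have expand: "(a + \<epsilon> * z)\<^sup>2 / (a\<^sup>2 * \<epsilon>) - 1 / \<epsilon> = 2 * z / a + \<epsilon> * z\<^sup>2 / a\<^sup>2" if "0 < \<epsilon>" for \<epsilon> z
    using that a_pos by (simp add: field_simps power2_eq_square)
  have lim: "((\<lambda>\<epsilon>. LINT z|lborel. ?i \<epsilon> z * (\<eta> z)\<^sup>2) \<longlongrightarrow> (LINT z|lborel. 2 * z / a * (\<eta> z)\<^sup>2)) (at_right 0)"
  proof (rule integral_dominated_convergence_at_right_0)
    \<comment> \<open>The majorant comes from \<open>expand\<close> by taking absolute values and
      replacing \<epsilon> by 1.\<close>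
    show "integrable lborel (\<lambda>z. 2 / a * (\<bar>z\<bar> ^ 1 * (\<eta> z)\<^sup>2) + 1 / a\<^sup>2 * (\<bar>z\<bar> ^ 2 * (\<eta> z)\<^sup>2))"
      by (intro Bochner_Integration.integrable_add integrable_mult_right
          schwartz_integrable_moment_square schwartz)
    have "((\<lambda>\<epsilon>. ?i \<epsilon> z) \<longlongrightarrow> 2 * z / a) (at_right 0)" for z
    proof -
      have lim: "((\<lambda>\<epsilon>. a + \<epsilon> * z) \<longlongrightarrow> a) (at_right 0)"
        by (auto intro!: tendsto_eq_intros)
      have "((\<lambda>\<epsilon>. 2 * z / a + \<epsilon> * z\<^sup>2 / a\<^sup>2) \<longlongrightarrow> 2 * z / a) (at_right 0)"
        using a_pos by (auto intro!: tendsto_eq_intros)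
      moreover have "\<forall>\<^sub>F \<epsilon> in at_right 0. 2 * z / a + \<epsilon> * z\<^sup>2 / a\<^sup>2 = ?i \<epsilon> z"
        using order_tendstoD(1)[OF lim a_pos] eventually_at_right_less[of 0]
        by eventually_elim (simp add: expand)
      ultimately show ?thesis
        by (rule Lim_transform_eventually)
    qed
    then show "AE z in lborel. ((\<lambda>\<epsilon>. ?i \<epsilon> z * (\<eta> z)\<^sup>2) \<longlongrightarrow> 2 * z / a * (\<eta> z)\<^sup>2) (at_right 0)"
      by (intro AE_I2 tendsto_mult tendsto_const)
    fix \<epsilon> :: real assume \<epsilon>: "0 < \<epsilon>" "\<epsilon> < 1"
    have "norm (?i \<epsilon> z * (\<eta> z)\<^sup>2) \<le> 2 / a * (\<bar>z\<bar> ^ 1 * (\<eta> z)\<^sup>2) + 1 / a\<^sup>2 * (\<bar>z\<bar> ^ 2 * (\<eta> z)\<^sup>2)" for z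
    proof -
      have "\<bar>?i \<epsilon> z\<bar> \<le> 2 / a * \<bar>z\<bar> + 1 / a\<^sup>2 * \<bar>z\<bar>\<^sup>2"
      proof (cases "0 \<le> a + \<epsilon> * z")
        case True
        then have "?i \<epsilon> z = 2 * z / a + \<epsilon> * z\<^sup>2 / a\<^sup>2"
          using expand[OF \<epsilon>(1)] by simp
        also have "\<bar>\<dots>\<bar> \<le> \<bar>2 * z / a\<bar> + \<bar>\<epsilon> * z\<^sup>2 / a\<^sup>2\<bar>"
          by (rule abs_triangle_ineq)
        also have "\<dots> \<le> 2 / a * \<bar>z\<bar> + 1 / a\<^sup>2 * \<bar>z\<bar>\<^sup>2"
          using a_pos \<epsilon> by (simp add: abs_mult divide_right_mono mult_left_le_one_le)
        finally show ?thesis .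
      next
        case False
        \<comment> \<open>On the part cut off by \<open>r \<ge> 0\<close> the factor \<open>1 / \<epsilon>\<close> is at most \<open>\<bar>z\<bar> / a\<close>.\<close>
        then have "a \<le> \<epsilon> * \<bar>z\<bar>"
          using mult_left_mono[OF abs_ge_minus_self[of z], of \<epsilon>] \<epsilon> by simp
        then have "1 / \<epsilon> \<le> \<bar>z\<bar> / a"
          using a_pos \<epsilon> by (simp add: field_simps)
        also have "\<dots> \<le> 2 / a * \<bar>z\<bar> + 1 / a\<^sup>2 * \<bar>z\<bar>\<^sup>2"
          using a_pos by (simp add: field_simps)
        finally show ?thesis
          using False \<epsilon> by simp
      qed
      then have "norm (?i \<epsilon> z * (\<eta> z)\<^sup>2) \<le> (2 / a * \<bar>z\<bar> + 1 / a\<^sup>2 * \<bar>z\<bar>\<^sup>2) * (\<eta> z)\<^sup>2"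
        unfolding real_norm_def abs_mult[of _ "(\<eta> z)\<^sup>2"] abs_power2 by (rule mult_right_mono) simp
      then show ?thesis
        by (simp add: algebra_simps)
    qed
    then show "AE z in lborel. norm (?i \<epsilon> z * (\<eta> z)\<^sup>2) \<le>
        2 / a * (\<bar>z\<bar> ^ 1 * (\<eta> z)\<^sup>2) + 1 / a\<^sup>2 * (\<bar>z\<bar> ^ 2 * (\<eta> z)\<^sup>2)"
      by simp
  qed simp_all
  have zero: "(LINT z|lborel. 2 * z / a * (\<eta> z)\<^sup>2) = 0"
  proof -
    have "(LINT z|lborel. 2 * z / a * (\<eta> z)\<^sup>2) = (LINT z|lborel. - (2 * z / a * (\<eta> z)\<^sup>2))"
      by (subst lborel_integral_real_affine[where c = "-1" and t = 0]) (simp_all add: even)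
    then show ?thesis
      unfolding Bochner_Integration.integral_minus by linarith
  qed
  have ev: "\<forall>\<^sub>F \<epsilon> in at_right 0. (LINT z|lborel. ?i \<epsilon> z * (\<eta> z)\<^sup>2) =
      (LINT r|lborel. indicator {0..} r * r\<^sup>2 * (Upsilon' \<eta> a \<epsilon> 1 r)\<^sup>2) - (LINT z|lborel. (\<eta> z)\<^sup>2) / \<epsilon>"
  proof (intro eventually_mono[OF eventually_at_right_less])
    fix \<epsilon> :: real assume \<epsilon>: "0 < \<epsilon>"
    let ?f = "\<lambda>z. indicator {0..} (a + \<epsilon> * z) * (a + \<epsilon> * z)\<^sup>2 * (Upsilon' \<eta> a \<epsilon> 1 (a + \<epsilon> * z))\<^sup>2"
    have "integrable lborel ?f"
      using lborel_integrable_real_affine[OF integrable_Upsilon'_1_square[OF \<epsilon>], of \<epsilon> a] \<epsilon> by simp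
    then have "\<epsilon> * (LINT z|lborel. ?f z) - (LINT z|lborel. (\<eta> z)\<^sup>2) / \<epsilon> =
        (LINT z|lborel. \<epsilon> * ?f z - (\<eta> z)\<^sup>2 / \<epsilon>)"
      using int by simp
    also have "\<dots> = (LINT z|lborel. ?i \<epsilon> z * (\<eta> z)\<^sup>2)"
      unfolding scaled_Upsilon'_1_square[OF \<epsilon>] using \<epsilon> a_pos
      by (intro Bochner_Integration.integral_cong) (simp_all add: field_simps power2_eq_square)
    also have "\<epsilon> * (LINT z|lborel. ?f z) =
        (LINT r|lborel. indicator {0..} r * r\<^sup>2 * (Upsilon' \<eta> a \<epsilon> 1 r)\<^sup>2)"
      using \<epsilon> by (subst (2) lborel_integral_real_affine[where c = \<epsilon> and t = a]) simp_all
    finally show "(LINT z|lborel. ?i \<epsilon> z * (\<eta> z)\<^sup>2) =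
      (LINT r|lborel. indicator {0..} r * r\<^sup>2 * (Upsilon' \<eta> a \<epsilon> 1 r)\<^sup>2) - (LINT z|lborel. (\<eta> z)\<^sup>2) / \<epsilon>" ..
  qed
  show ?thesis
    by (rule Lim_transform_eventually[OF lim[unfolded zero] ev])
qed

section \<open>Radial form of the self-energy and assembly of the limits\<close>

lemma U_ele_eq_radial:
  assumes "0 < \<epsilon>"
  shows "U_ele \<eta> e a \<epsilon> = e\<^sup>2 / 2 *
    (LINT r|lborel. indicator {0..} r * r\<^sup>2 * (Upsilon \<eta> a \<epsilon> 2 r - Upsilon' \<eta> a \<epsilon> 1 r)\<^sup>2)"
proof -
  let ?E = "\<lambda>r. (e * (Upsilon \<eta> a \<epsilon> 2 r - Upsilon' \<eta> a \<epsilon> 1 r))\<^sup>2"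
  \<comment> \<open>At the origin \<open>sgn\<close> is 0 and not a unit vector; the weight r^2
    later absorbs this exception.\<close>
  have "(norm (E_field \<eta> e a \<epsilon> x))\<^sup>2 = (if norm x = 0 then 0 else ?E (norm x))" for x
    by (simp add: E_field_def norm_sgn power_mult_distrib)
  then have "U_ele \<eta> e a \<epsilon> = 1 / (8 * pi) *
      (LINT x|(lborel :: (real ^ 3) measure). (\<lambda>r. if r = 0 then 0 else ?E r) (norm x))"
    unfolding U_ele_def by simp
  \<comment> \<open>The unit ball has volume 4 pi / 3; multiplied by the dimension 3 and by 1/(8 pi)
    this gives 1/2.\<close>
  also have "\<dots> = 1 / 2 * (LINT r|lborel. indicator {0..} r * r\<^sup>2 * (if r = 0 then 0 else ?E r))"
    using assms by (subst integral_norm_polar) (simp_all add: unit_ball_vol_3 del: One_nat_def)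
  also have "\<dots> = 1 / 2 * (LINT r|lborel. e\<^sup>2 *
      (indicator {0..} r * r\<^sup>2 * (Upsilon \<eta> a \<epsilon> 2 r - Upsilon' \<eta> a \<epsilon> 1 r)\<^sup>2))"
    by (rule arg_cong2[where f = "(*)", OF refl Bochner_Integration.integral_cong[OF refl]])
       (simp add: power_mult_distrib)
  finally show ?thesis by simp
qed

lemma tendsto_U_ele:
  "((\<lambda>\<epsilon>. U_ele \<eta> e a \<epsilon> - e\<^sup>2 / 2 * ((LINT z|lborel. (\<eta> z)\<^sup>2) / \<epsilon>)) \<longlongrightarrow> 0) (at_right 0)"
proof -
  let ?M = "LINT z|lborel. (\<eta> z)\<^sup>2"
  define A B D where
    "A \<epsilon> = (LINT r|lborel. indicator {0..} r * r\<^sup>2 * (Upsilon \<eta> a \<epsilon> 2 r)\<^sup>2)" and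
    "B \<epsilon> = (LINT r|lborel. indicator {0..} r * r\<^sup>2 * (Upsilon \<eta> a \<epsilon> 2 r * Upsilon' \<eta> a \<epsilon> 1 r))" and
    "D \<epsilon> = (LINT r|lborel. indicator {0..} r * r\<^sup>2 * (Upsilon' \<eta> a \<epsilon> 1 r)\<^sup>2)" for \<epsilon>
  \<comment> \<open>The divergent part is attached to \<open>D\<close> alone, so that each of the
    three summands has a finite limit.\<close>
  have "((\<lambda>\<epsilon>. e\<^sup>2 / 2 * (A \<epsilon> - 2 * B \<epsilon> + (D \<epsilon> - ?M / \<epsilon>))) \<longlongrightarrow>
      e\<^sup>2 / 2 * (1 / a - 2 * (1 / (2 * a)) + 0)) (at_right 0)"
    unfolding A_def B_def D_def
    by (intro tendsto_intros tendsto_integral_Upsilon_2_square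
        tendsto_integral_Upsilon_2_Upsilon'_1 tendsto_integral_Upsilon'_1_square)
  moreover have "\<forall>\<^sub>F \<epsilon> in at_right 0. e\<^sup>2 / 2 * (A \<epsilon> - 2 * B \<epsilon> + (D \<epsilon> - ?M / \<epsilon>)) =
      U_ele \<eta> e a \<epsilon> - e\<^sup>2 / 2 * (?M / \<epsilon>)"
  \<comment> \<open>The integrability of the squared \<open>Upsilon\<close> is available for
    \<epsilon> in ]0,1[.\<close>
  proof (rule eventually_mono[OF eventually_at_right_real[OF zero_less_one]])
    fix \<epsilon> :: real assume "\<epsilon> \<in> {0<..<1}"
    then have \<epsilon>: "0 < \<epsilon>" "\<epsilon> < 1" by auto
    let ?u = "Upsilon \<eta> a \<epsilon> 2" and ?v = "Upsilon' \<eta> a \<epsilon> 1"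
    note int = integrable_Upsilon_2_square[OF \<epsilon>] integrable_Upsilon'_1_square[OF \<epsilon>(1)]
    have int_uv: "integrable lborel (\<lambda>r. indicator {0..} r * r\<^sup>2 * (?u r * ?v r))"
    proof (rule integrable_abs_bound[OF Bochner_Integration.integrable_add[OF int]])
      show "(\<lambda>r. indicator {0..} r * r\<^sup>2 * (?u r * ?v r)) \<in> borel_measurable lborel"
        using \<epsilon>(1) by (simp del: One_nat_def)
      fix r
      \<comment> \<open>From 2 |u| |v| \<le> u^2 + v^2, dropping the factor 2; integrability of the
        product thus follows from that of the two squares.\<close>
      have "\<bar>?u r * ?v r\<bar> \<le> (?u r)\<^sup>2 + (?v r)\<^sup>2"
        using sum_squares_bound[of "\<bar>?u r\<bar>" "\<bar>?v r\<bar>"] abs_ge_zero[of "?u r * ?v r"]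
        unfolding power2_abs abs_mult mult.assoc by linarith
      then have "indicator {0..} r * r\<^sup>2 * \<bar>?u r * ?v r\<bar> \<le> indicator {0..} r * r\<^sup>2 * ((?u r)\<^sup>2 + (?v r)\<^sup>2)"
        by (intro mult_left_mono) auto
      then show "\<bar>indicator {0..} r * r\<^sup>2 * (?u r * ?v r)\<bar> \<le>
          indicator {0..} r * r\<^sup>2 * (?u r)\<^sup>2 + indicator {0..} r * r\<^sup>2 * (?v r)\<^sup>2"
        by (simp add: abs_mult distrib_left)
    qed
    have "A \<epsilon> - 2 * B \<epsilon> + D \<epsilon> = (LINT r|lborel. indicator {0..} r * r\<^sup>2 * (?u r)\<^sup>2 -
        2 * (indicator {0..} r * r\<^sup>2 * (?u r * ?v r)) + indicator {0..} r * r\<^sup>2 * (?v r)\<^sup>2)"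
      unfolding A_def B_def D_def using int int_uv by (simp del: One_nat_def)
    also have "\<dots> = (LINT r|lborel. indicator {0..} r * r\<^sup>2 * (?u r - ?v r)\<^sup>2)"
      by (simp add: power2_diff algebra_simps del: One_nat_def)
    finally show "e\<^sup>2 / 2 * (A \<epsilon> - 2 * B \<epsilon> + (D \<epsilon> - ?M / \<epsilon>)) = U_ele \<eta> e a \<epsilon> - e\<^sup>2 / 2 * (?M / \<epsilon>)"
      unfolding U_ele_eq_radial[OF \<epsilon>(1)] by (simp add: algebra_simps)
  qed
  ultimately show ?thesis
    by (simp add: Lim_transform_eventually)
qed

end

theorem mainTheorem1:
  fixes \<eta> :: "real \<Rightarrow> real" and e M :: real
  assumes "mollifier \<eta>"
    and "M = (LINT z|lborel. (\<eta> (- z))\<^sup>2)"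
  shows "(\<forall>a\<in>{0<..<1}.
            ((\<lambda>\<epsilon>. U_ele \<eta> e a \<epsilon> - e\<^sup>2 / 2 * (M / \<epsilon>)) \<longlongrightarrow> 0) (at_right 0)) \<and>
         (\<forall>a\<in>{0<..<1}. \<forall>b\<in>{0<..<1}.
            ((\<lambda>\<epsilon>. U_ele \<eta> e a \<epsilon> - U_ele \<eta> e b \<epsilon>) \<longlongrightarrow> 0) (at_right 0))"
proof -
  have M: "M = (LINT z|lborel. (\<eta> z)\<^sup>2)"
    using assms by (simp add: mollifier_def)
  have *: "((\<lambda>\<epsilon>. U_ele \<eta> e a \<epsilon> - e\<^sup>2 / 2 * (M / \<epsilon>)) \<longlongrightarrow> 0) (at_right 0)" if "a \<in> {0<..<1}" for a
  proof -
    interpret mollified_charge \<eta> a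
      using assms(1) that by unfold_locales auto
    show ?thesis
      unfolding M by (rule tendsto_U_ele)
  qed
  \<comment> \<open>The subtracted term e^2 M / (2 \<epsilon>) is the same for both radii and
    cancels in the difference.\<close>
  have "((\<lambda>\<epsilon>. U_ele \<eta> e a \<epsilon> - U_ele \<eta> e b \<epsilon>) \<longlongrightarrow> 0) (at_right 0)"
    if "a \<in> {0<..<1}" "b \<in> {0<..<1}" for a b
    using tendsto_diff[OF *[OF that(1)] *[OF that(2)]] by simp
  with * show ?thesis by blast
qed

end
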